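(* Let $0<\alpha<1$ and $\gamma>0$ be fixed. As $m\to\infty$, $$-\frac{d_m}{m\,t_m}=1+O(m^{-1}).$$
   Context: For $n\ge0$, $t_n=t_n(\alpha,\gamma):=(-1)^n\gamma^{-n}\sum_{i=0}^nS(n,i)(\gamma)_i\left(\frac{\alpha}{1-\alpha}\right)^i$, where $S(n,i)$ is the Stirling number of the second kind (with $S(0,0)=1$, so $t_0=1$) and $(\gamma)_i$ is the Pochhammer symbol. The sequence $d_m$, $m\ge1$, is defined by the formal power series identity $\sum_{n\ge1}d_nx^n=xA'(x)/A(x)$ with $A(x)=\left(1+\sum_{l\ge1}t_lx^l\right)^{-1}$; equivalently $d_m=-\sum_{n=1}^{m-1}d_nt_{m-n}-mt_m$ for $m\ge1$. Implied constants may depend on $\alpha,\gamma$. *)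

theory Defs
  imports
    Complex_Main
    "HOL-Combinatorics.Stirling"
    "HOL-Computational_Algebra.Formal_Power_Series"
    "HOL-Library.Landau_Symbols"
begin

(* The Pochhammer symbol is the rising factorial gamma (gamma+1) ... (gamma+i-1), so the sum is
   the n-th moment of a negative binomial distribution. *)
definition t :: "real \<Rightarrow> real \<Rightarrow> nat \<Rightarrow> real" where
  "t \<alpha> \<gamma> n =
     (-1) ^ n * \<gamma> powi (- int n) *
       (\<Sum>i=0..n. real (Stirling n i) * pochhammer \<gamma> i * (\<alpha> / (1 - \<alpha>)) ^ i)"

definition A :: "real \<Rightarrow> real \<Rightarrow> real fps" where
  "A \<alpha> \<gamma> = inverse (1 + Abs_fps (\<lambda>l. if l \<ge> 1 then t \<alpha> \<gamma> l else 0))"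

(* The constant coefficient of A is 1, so the quotient is an honest division by a unit;
   only the values at m >= 1 are meaningful (the value at 0 is 0). *)
definition d :: "real \<Rightarrow> real \<Rightarrow> nat \<Rightarrow> real" where
  "d \<alpha> \<gamma> m = fps_nth (fps_X * fps_deriv (A \<alpha> \<gamma>) / A \<alpha> \<gamma>) m"

end

theory Submission
  imports Defs "HOL-Analysis.Generalised_Binomial_Theorem"
begin

text \<open>Up to sign, \<open>t\<^sub>n\<close> is the \<open>n\<close>-th moment of a negative binomial variable divided by \<open>\<gamma>\<^sup>n\<close>. Moments
  are log-convex by Cauchy-Schwarz, and the ratio \<open>p\<^sub>k\<^sub>+\<^sub>1 / p\<^sub>k = \<alpha> (\<gamma> + k) / (k + 1)\<close> of the weights makes
  consecutive moments grow by a factor of order \<open>n\<close>. For such a sequence the convolution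
  \<open>\<Sum> n |t\<^sub>n| |t\<^sub>m\<^sub>-\<^sub>n|\<close> over \<open>0 < n < m\<close> is dominated by its extreme terms and hence \<open>O(|t\<^sub>m|)\<close>,
  so the recursion for \<open>d\<^sub>m\<close> first yields \<open>d\<^sub>n = O(n |t\<^sub>n|)\<close> and then \<open>d\<^sub>m = - m t\<^sub>m + O(|t\<^sub>m|)\<close>.\<close>

section \<open>Moments of the negative binomial distribution\<close>

text \<open>\<open>fact i * (k choose i)\<close> is the falling factorial of length
  \<open>i\<close>. Multiplying it by \<open>k = i + (k - i)\<close> gives \<open>i\<close> times
  itself plus the next falling factorial, which matches the Stirling recurrence.\<close>

lemma power_eq_sum_Stirling_binomial:
  "(of_nat k :: 'a :: comm_semiring_1) ^ n = (\<Sum>i\<le>n. of_nat (Stirling n i * fact i * (k choose i)))"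
proof -
  have step: "k * (fact i * (k choose i)) = i * (fact i * (k choose i)) + fact (Suc i) * (k choose Suc i)"
    for i
  proof (cases "i \<le> k")
    case True
    have "Suc i * (k choose Suc i) = (k - i) * (k choose i)"
      by (metis binomial_absorb_comp binomial_absorption mult.commute)
    then have "fact (Suc i) * (k choose Suc i) = (k - i) * (fact i * (k choose i))"
      by (simp only: fact_Suc of_nat_id mult.commute mult.left_commute mult.assoc)
    then show ?thesis
      using True by (metis add_mult_distrib le_add_diff_inverse)
  qed (simp add: binomial_eq_0)
  have "k ^ n = (\<Sum>i\<le>n. Stirling n i * (fact i * (k choose i)))"
  proof (induction n)
    case (Suc n)
    have "k ^ Suc n = (\<Sum>i\<le>n. Stirling n i * (i * (fact i * (k choose i)) + fact (Suc i) * (k choose Suc i)))"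
      unfolding power_Suc Suc.IH sum_distrib_left step[symmetric] by (simp add: mult_ac)
    \<comment> \<open>The range may grow to \<open>Suc n\<close> because
      \<open>Stirling n (Suc n) = 0\<close>; the shift below loses nothing because the term at
      \<open>i = 0\<close> carries the factor 0.\<close>
    also have "\<dots> = (\<Sum>i\<le>Suc n. i * Stirling n i * (fact i * (k choose i)))
                  + (\<Sum>i\<le>n. Stirling n i * (fact (Suc i) * (k choose Suc i)))"
      by (simp add: distrib_left sum.distrib mult_ac)
    also have "(\<Sum>i\<le>Suc n. i * Stirling n i * (fact i * (k choose i)))
        = (\<Sum>i\<le>n. Suc i * Stirling n (Suc i) * (fact (Suc i) * (k choose Suc i)))"
      by (subst sum.atMost_Suc_shift) simp
    finally show ?case
      by (subst sum.atMost_Suc_shift) (simp add: sum.distrib algebra_simps)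
  qed simp
  then have "(of_nat (k ^ n) :: 'a) = of_nat (\<Sum>i\<le>n. Stirling n i * (fact i * (k choose i)))"
    by (rule arg_cong)
  then show ?thesis
    by (simp only: of_nat_power of_nat_sum mult.assoc)
qed

text \<open>The probability mass function of the negative binomial law;
  \<open>(1 - \<alpha>) powr \<gamma>\<close> normalises the total mass to 1.\<close>

definition nbin_weight :: "real \<Rightarrow> real \<Rightarrow> nat \<Rightarrow> real" where
  "nbin_weight \<alpha> \<gamma> k = (1 - \<alpha>) powr \<gamma> * pochhammer \<gamma> k / fact k * \<alpha> ^ k"

text \<open>Defined by the finite Stirling sum, so that the link with \<open>t\<close> is immediate;
  \<open>nbin_moment_sums\<close> identifies it as a moment.\<close>

definition nbin_moment :: "real \<Rightarrow> real \<Rightarrow> nat \<Rightarrow> real" where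
  "nbin_moment \<alpha> \<gamma> n = (\<Sum>i\<le>n. real (Stirling n i) * pochhammer \<gamma> i * (\<alpha> / (1 - \<alpha>)) ^ i)"

text \<open>Newton's binomial series with exponent \<open>- a\<close> at \<open>- x\<close>, where
  the signs cancel.\<close>

lemma pochhammer_series_sums:
  fixes x a :: real
  assumes "\<bar>x\<bar> < 1"
  shows "(\<lambda>k. pochhammer a k / fact k * x ^ k) sums (1 - x) powr (- a)"
proof -
  have "(\<lambda>k. ((- a) gchoose k) * (- x) ^ k) sums (1 + (- x)) powr (- a)"
    by (rule gen_binomial_real) (use assms in auto)
  moreover have "((- a) gchoose k) * (- x) ^ k = pochhammer a k / fact k * x ^ k" for k
    by (simp add: gbinomial_pochhammer uminus_power_if)
  ultimately show ?thesis by simp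
qed

lemma nbin_weight_pos:
  assumes "0 < \<alpha>" "\<alpha> < 1" "\<gamma> > 0"
  shows "nbin_weight \<alpha> \<gamma> k > 0"
  using assms by (simp add: nbin_weight_def pochhammer_pos)

lemma nbin_weight_Suc:
  "nbin_weight \<alpha> \<gamma> (Suc k) * real (Suc k) = \<alpha> * (\<gamma> + real k) * nbin_weight \<alpha> \<gamma> k"
  by (simp add: nbin_weight_def pochhammer_Suc field_simps del: of_nat_Suc)

text \<open>Terms with \<open>k < i\<close> vanish. After a shift by \<open>i\<close> the factorials
  cancel and the Pochhammer symbol splits, leaving a constant times the binomial series with
  parameter \<open>\<gamma> + i\<close>.\<close>

lemma nbin_factorial_moment_sums:
  assumes "0 < \<alpha>" "\<alpha> < 1"
  shows "(\<lambda>k. nbin_weight \<alpha> \<gamma> k * (fact i * real (k choose i))) sums (pochhammer \<gamma> i * (\<alpha> / (1 - \<alpha>)) ^ i)"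
proof -
  define C where "C = (1 - \<alpha>) powr \<gamma> * pochhammer \<gamma> i * \<alpha> ^ i"
  have "(\<lambda>k. C * (pochhammer (\<gamma> + real i) k / fact k * \<alpha> ^ k)) sums (C * (1 - \<alpha>) powr (- (\<gamma> + real i)))"
    by (intro sums_mult pochhammer_series_sums) (use assms in auto)
  also have "C * (1 - \<alpha>) powr (- (\<gamma> + real i)) = pochhammer \<gamma> i * (\<alpha> / (1 - \<alpha>)) ^ i"
  proof -
    have "(1 - \<alpha>) powr (- (\<gamma> + real i)) = inverse ((1 - \<alpha>) powr \<gamma> * (1 - \<alpha>) ^ i)"
      using assms by (simp only: powr_minus powr_add) (simp add: powr_realpow)
    then show ?thesis
      using assms by (simp add: C_def field_simps)
  qed
  also have "(\<lambda>k. C * (pochhammer (\<gamma> + real i) k / fact k * \<alpha> ^ k))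
      = (\<lambda>k. nbin_weight \<alpha> \<gamma> (k + i) * (fact i * real (k + i choose i)))"
  proof
    fix k
    have "fact i * real (k + i choose i) = fact (k + i) / fact k"
      by (simp add: binomial_fact)
    moreover have "pochhammer \<gamma> (k + i) = pochhammer \<gamma> i * pochhammer (\<gamma> + real i) k"
      by (metis pochhammer_product' add.commute)
    ultimately show "C * (pochhammer (\<gamma> + real i) k / fact k * \<alpha> ^ k)
        = nbin_weight \<alpha> \<gamma> (k + i) * (fact i * real (k + i choose i))"
      by (simp add: C_def nbin_weight_def power_add)
  qed
  finally show ?thesis
    by (subst (asm) sums_iff_shift) (simp add: binomial_eq_0)
qed

lemma nbin_moment_sums:
  assumes "0 < \<alpha>" "\<alpha> < 1"
  shows "(\<lambda>k. nbin_weight \<alpha> \<gamma> k * real k ^ n) sums nbin_moment \<alpha> \<gamma> n"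
proof -
  have "(\<lambda>k. \<Sum>i\<le>n. real (Stirling n i) * (nbin_weight \<alpha> \<gamma> k * (fact i * real (k choose i))))
      sums (\<Sum>i\<le>n. real (Stirling n i) * (pochhammer \<gamma> i * (\<alpha> / (1 - \<alpha>)) ^ i))"
    by (intro sums_sum sums_mult nbin_factorial_moment_sums assms)
  then show ?thesis
    by (simp add: power_eq_sum_Stirling_binomial nbin_moment_def sum_distrib_left mult_ac)
qed

lemma nbin_moment_pos:
  assumes "0 < \<alpha>" "\<alpha> < 1" "\<gamma> > 0"
  shows "nbin_moment \<alpha> \<gamma> n > 0"
proof -
  \<comment> \<open>The term at \<open>k = 1\<close> is positive for every \<open>n\<close>, whereas
    the one at \<open>k = 0\<close> vanishes once \<open>n > 0\<close>.\<close>
  have "0 < nbin_weight \<alpha> \<gamma> 1 * real 1 ^ n"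
    using nbin_weight_pos[OF assms, of 1] by simp
  also have "\<dots> \<le> (\<Sum>k. nbin_weight \<alpha> \<gamma> k * real k ^ n)"
    using sum_le_suminf[OF sums_summable[OF nbin_moment_sums[OF assms(1,2)]], of "{1}" \<gamma> n]
      nbin_weight_pos[OF assms] by (simp add: less_imp_le)
  also have "\<dots> = nbin_moment \<alpha> \<gamma> n"
    using nbin_moment_sums[OF assms(1,2)] by (simp add: sums_iff)
  finally show ?thesis .
qed

lemma nbin_moment_log_convex:
  assumes "0 < \<alpha>" "\<alpha> < 1" "\<gamma> > 0"
  shows "(nbin_moment \<alpha> \<gamma> (Suc n))\<^sup>2 \<le> nbin_moment \<alpha> \<gamma> n * nbin_moment \<alpha> \<gamma> (Suc (Suc n))"
proof -
  let ?M = "nbin_moment \<alpha> \<gamma>"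
  \<comment> \<open>The minimiser of the quadratic in \<open>s\<close> obtained by summing
    \<open>w k * k ^ n * (k - s)\<^sup>2\<close>, \<open>w\<close> being the weights; nonnegativity
    at the minimum is the Cauchy-Schwarz inequality.\<close>
  define s where "s = ?M (Suc n) / ?M n"
  have pos: "?M n > 0" by (rule nbin_moment_pos[OF assms])
  have "(\<lambda>k. nbin_weight \<alpha> \<gamma> k * real k ^ Suc (Suc n) - 2 * s * (nbin_weight \<alpha> \<gamma> k * real k ^ Suc n)
          + s\<^sup>2 * (nbin_weight \<alpha> \<gamma> k * real k ^ n))
        sums (?M (Suc (Suc n)) - 2 * s * ?M (Suc n) + s\<^sup>2 * ?M n)"
    by (intro sums_add sums_diff sums_mult nbin_moment_sums assms)
  moreover have "nbin_weight \<alpha> \<gamma> k * real k ^ Suc (Suc n) - 2 * s * (nbin_weight \<alpha> \<gamma> k * real k ^ Suc n)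
          + s\<^sup>2 * (nbin_weight \<alpha> \<gamma> k * real k ^ n) = nbin_weight \<alpha> \<gamma> k * real k ^ n * (real k - s)\<^sup>2" for k
    by (simp add: power2_eq_square algebra_simps)
  ultimately have "(\<lambda>k. nbin_weight \<alpha> \<gamma> k * real k ^ n * (real k - s)\<^sup>2)
      sums (?M (Suc (Suc n)) - 2 * s * ?M (Suc n) + s\<^sup>2 * ?M n)"
    by (simp only:)
  then have "0 \<le> ?M (Suc (Suc n)) - 2 * s * ?M (Suc n) + s\<^sup>2 * ?M n"
    by (rule sums_le[OF _ sums_zero, rotated]) (simp add: nbin_weight_pos[OF assms] less_imp_le)
  then show ?thesis
    using pos by (simp add: s_def field_simps power2_eq_square)
qed

text \<open>Shifting the index and using the weight ratio turns the moment of order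
  \<open>n + 1\<close> into \<alpha> times the sum of
  \<open>w k * (\<gamma> + k) * (k + 1) ^ n\<close>, with \<open>w\<close> the weights. Dropping
  \<gamma> and keeping two terms of the binomial expansion bounds it below by
  \<open>\<alpha> * (M (n + 1) + n * M n)\<close>, which is then solved for
  \<open>M (n + 1)\<close>.\<close>

lemma nbin_moment_growth:
  assumes "0 < \<alpha>" "\<alpha> < 1" "\<gamma> > 0"
  shows "\<alpha> / (1 - \<alpha>) * real n * nbin_moment \<alpha> \<gamma> n \<le> nbin_moment \<alpha> \<gamma> (Suc n)"
proof -
  let ?M = "nbin_moment \<alpha> \<gamma>" and ?w = "nbin_weight \<alpha> \<gamma>"
  have le: "k ^ Suc n + n * k ^ n \<le> k * (k + 1) ^ n" for k :: nat
  proof (induction n)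
    case (Suc n)
    have "k ^ Suc (Suc n) + Suc n * k ^ Suc n \<le> (k + 1) * (k ^ Suc n + n * k ^ n)"
      by (simp add: algebra_simps)
    also have "\<dots> \<le> (k + 1) * (k * (k + 1) ^ n)"
      using Suc.IH by (rule mult_le_mono2)
    finally show ?case by (simp add: mult_ac)
  qed simp
  have sums1: "(\<lambda>k. ?w (Suc k) * real (Suc k) ^ Suc n) sums ?M (Suc n)"
    using nbin_moment_sums[OF assms(1,2), of \<gamma> "Suc n"] by (subst sums_Suc_iff) simp
  have sums2: "(\<lambda>k. \<alpha> * (?w k * real k ^ Suc n + real n * (?w k * real k ^ n)))
      sums (\<alpha> * (?M (Suc n) + real n * ?M n))"
    by (intro sums_add sums_mult nbin_moment_sums assms)
  have "\<alpha> * (?w k * real k ^ Suc n + real n * (?w k * real k ^ n))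
      \<le> ?w (Suc k) * real (Suc k) ^ Suc n" for k
  proof -
    have "real (k ^ Suc n + n * k ^ n) \<le> real (k * (k + 1) ^ n)"
      using le[of k] by (simp only: of_nat_le_iff)
    then have "real k ^ Suc n + real n * real k ^ n \<le> real k * real (Suc k) ^ n"
      by (simp only: of_nat_add of_nat_mult of_nat_power Suc_eq_plus1)
    also have "\<dots> \<le> (\<gamma> + real k) * real (Suc k) ^ n"
      using assms by (intro mult_right_mono) auto
    finally have "\<alpha> * ?w k * (real k ^ Suc n + real n * real k ^ n)
        \<le> \<alpha> * ?w k * ((\<gamma> + real k) * real (Suc k) ^ n)"
      using assms nbin_weight_pos[OF assms, of k] by (intro mult_left_mono) auto
    also have "\<dots> = ?w (Suc k) * real (Suc k) ^ Suc n"
      using nbin_weight_Suc[of \<alpha> \<gamma> k] by (simp add: mult_ac)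
    finally show ?thesis by (simp add: algebra_simps)
  qed
  then have "\<alpha> * (?M (Suc n) + real n * ?M n) \<le> ?M (Suc n)"
    by (rule sums_le[OF _ sums2 sums1])
  then have "\<alpha> * (real n * ?M n) \<le> (1 - \<alpha>) * ?M (Suc n)"
    by (simp add: algebra_simps)
  then have "\<alpha> * (real n * ?M n) / (1 - \<alpha>) \<le> ?M (Suc n)"
    using assms by (simp add: pos_divide_le_eq mult.commute)
  then show ?thesis by simp
qed

section \<open>Convolutions of log-convex sequences\<close>

text \<open>Log-convexity makes the successive ratios increase, so \<open>a\<close> steps from
  \<open>l\<close> multiply \<open>u\<close> by no more than \<open>a\<close> steps from
  \<open>l + b\<close>.\<close>

lemma log_convex_mult_le:
  fixes u :: "nat \<Rightarrow> real"
  assumes pos: "\<And>n. u n > 0"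
    and convex: "\<And>n. (u (Suc n))\<^sup>2 \<le> u n * u (Suc (Suc n))"
  shows "u (l + a) * u (l + b) \<le> u l * u (l + a + b)"
proof -
  define q where "q n = u (Suc n) / u n" for n
  have "incseq q"
    unfolding q_def
    by (rule incseq_SucI) (use pos convex in \<open>simp add: field_simps power2_eq_square\<close>)
  have u_Suc: "u (Suc n) = q n * u n" for n
    using pos[of n] by (simp add: q_def)
  have q_pos: "q n > 0" for n
    using pos by (simp add: q_def)
  show ?thesis
  proof (induction a)
    case (Suc a)
    have "u (l + Suc a) * u (l + b) = q (l + a) * (u (l + a) * u (l + b))"
      by (simp add: u_Suc)
    also have "\<dots> \<le> q (l + a + b) * (u l * u (l + a + b))"
      by (rule mult_mono[OF incseqD[OF \<open>incseq q\<close>] Suc.IH]) (simp_all add: pos q_pos less_imp_le)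
    also have "\<dots> = u l * u (l + Suc a + b)"
      by (simp add: u_Suc)
    finally show ?case .
  qed (simp add: pos)
qed

text \<open>The two end terms are each O(\<open>u m\<close>) by one growth step. An interior product
  is at most \<open>u 2 * u (m - 2)\<close>; two growth steps gain order \<open>m\<^sup>2\<close>
  against the weight \<open>n < m\<close>, so the fewer than \<open>m\<close> interior terms also
  total O(\<open>u m\<close>).\<close>

lemma weighted_convolution_le:
  fixes u :: "nat \<Rightarrow> real"
  assumes pos: "\<And>n. u n > 0"
    and convex: "\<And>n. (u (Suc n))\<^sup>2 \<le> u n * u (Suc (Suc n))"
    and c: "c > 0"
    and growth: "\<And>n. c * real n * u n \<le> u (Suc n)"
  shows "(\<Sum>n=1..<m. real n * u n * u (m - n)) \<le> (2 * u 1 / c + 9 * u 2 / c\<^sup>2) * u m"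
proof -
  define D where "D = u 1 / c * u m"
  define E where "E = 9 * u 2 / c\<^sup>2 * u m"
  have D: "D \<ge> 0" and E: "E \<ge> 0"
    using pos[of 1] pos[of 2] pos[of m] c by (auto simp: D_def E_def)
  then have E_div: "E / real m \<ge> 0" by simp
  \<comment> \<open>For \<open>m = 2\<close> the two end terms coincide; counting \<open>D\<close>
    twice is harmless.\<close>
  have "real n * u n * u (m - n) \<le> (if n = 1 then D else 0) + (if n = m - 1 then D else 0) + E / real m"
    if n: "n \<in> {1..<m}" for n
  proof -
    have growth': "real (m - 1) * u (m - 1) \<le> u m / c"
      using growth[of "m - 1"] n c by (simp add: field_simps)
    consider "n = m - 1" | "n = 1" "n \<noteq> m - 1" | "2 \<le> n" "n \<le> m - 2"
      using n by fastforce
    then show ?thesis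
    proof cases
      case 1
      have "real n * u n * u (m - n) = u 1 * (real (m - 1) * u (m - 1))"
        using 1 n by simp
      also have "\<dots> \<le> D"
        using mult_left_mono[OF growth', of "u 1"] pos[of 1] by (simp add: D_def)
      finally show ?thesis
        unfolding if_P[OF 1] using D E_div by (cases "n = 1") simp_all
    next
      case 2
      have "u (m - 1) \<le> real (m - 1) * u (m - 1)"
        using n pos[of "m - 1"] by simp
      also note growth'
      finally have "u 1 * u (m - 1) \<le> D"
        using mult_left_mono[of "u (m - 1)" "u m / c" "u 1"] pos[of 1] by (simp add: D_def)
      then show ?thesis using 2 E_div by simp
    next
      case 3
      define k where "k = m - 2"
      have m: "m = Suc (Suc k)" and k: "k \<ge> 2" using 3 by (auto simp: k_def)
      \<comment> \<open>Both indices are at least 2, so log-convexity pushes the pair out to 2 and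
        \<open>m - 2\<close>.\<close>
      have "2 + (n - 2) = n" "2 + (m - n - 2) = m - n" "2 + (n - 2) + (m - n - 2) = k"
        using 3 by (auto simp: k_def)
      then have "u n * u (m - n) \<le> u 2 * u k"
        using log_convex_mult_le[where u = u and l = 2 and a = "n - 2" and b = "m - n - 2", OF pos convex]
        by (simp only:)
      also have "u k \<le> u m / (c\<^sup>2 * real k * real (Suc k))"
      proof -
        have "c\<^sup>2 * real k * real (Suc k) * u k = c * real (Suc k) * (c * real k * u k)"
          by (simp add: power2_eq_square)
        also have "\<dots> \<le> c * real (Suc k) * u (Suc k)"
          using c by (intro mult_left_mono growth) simp
        also have "\<dots> \<le> u m" unfolding m by (rule growth)
        finally have "u k * (c\<^sup>2 * real k * real (Suc k)) \<le> u m"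
          by (simp only: mult.commute)
        moreover have "0 < c\<^sup>2 * real k * real (Suc k)"
          using c k by simp
        ultimately show ?thesis
          by (simp only: pos_le_divide_eq)
      qed
      finally have "u n * u (m - n) \<le> u 2 * (u m / (c\<^sup>2 * real k * real (Suc k)))"
        using pos[of 2] by simp
      then have "real n * (u n * u (m - n)) \<le> real m * (u 2 * (u m / (c\<^sup>2 * real k * real (Suc k))))"
        by (rule mult_mono[rotated]) (use n pos in \<open>auto simp: less_imp_le\<close>)
      also have "\<dots> = u 2 * u m / c\<^sup>2 * (real m / (real k * real (Suc k)))"
        by (simp add: mult_ac)
      also have "\<dots> \<le> u 2 * u m / c\<^sup>2 * (9 / real m)"
      proof (rule mult_left_mono)
        \<comment> \<open>Since \<open>k \<ge> 2\<close>, \<open>m = k + 2 \<le> 2 * k\<close>, so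
          the constant 9 is generous.\<close>
        have "real m * real m \<le> 9 * (real k * real (Suc k))"
          unfolding m using k mult_mono[of 2 "real k" 2 "real k"] by (simp add: algebra_simps)
        then show "real m / (real k * real (Suc k)) \<le> 9 / real m"
          using k m by (simp add: divide_simps del: of_nat_Suc)
      qed (use pos[of 2] pos[of m] in simp)
      finally have "real n * u n * u (m - n) \<le> E / real m"
        by (simp add: E_def mult_ac)
      then show ?thesis using D by (simp add: add_increasing)
    qed
  qed
  then have "(\<Sum>n=1..<m. real n * u n * u (m - n))
      \<le> (\<Sum>n=1..<m. (if n = 1 then D else 0) + (if n = m - 1 then D else 0) + E / real m)"
    by (rule sum_mono)
  also have "\<dots> \<le> D + D + E"
  proof -
    have "(\<Sum>n=1..<m. if n = j then D else 0) \<le> D" for j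
      using D by (simp add: sum.delta)
    moreover have "(\<Sum>n=1..<m. E / real m) \<le> E"
    proof -
      have "(\<Sum>n=1..<m. E / real m) = E * (real (m - 1) / real m)"
        by simp
      also have "\<dots> \<le> E"
        by (rule mult_left_le[OF _ E]) (auto simp: divide_le_eq)
      finally show ?thesis .
    qed
    ultimately show ?thesis
      unfolding sum.distrib by (intro add_mono)
  qed
  finally show ?thesis
    by (simp add: D_def E_def algebra_simps)
qed

text \<open>A bootstrap: a bound \<open>\<bar>e n\<bar> \<le> K * n * u n\<close> below
  \<open>m\<close> leaves an error of \<open>K * B * u m\<close>, smaller than
  \<open>K * m * u m\<close> by the factor \<open>B / m\<close>. This closes the induction for large
  \<open>m\<close> and then gives the claim with constant \<open>K * B\<close>.\<close>

lemma convolution_recursion_bound: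
  fixes u e :: "nat \<Rightarrow> real"
  assumes pos: "\<And>n. u n > 0"
    and conv: "\<And>m. (\<Sum>n=1..<m. real n * u n * u (m - n)) \<le> B * u m"
    and rec: "\<And>m. m \<ge> 1 \<Longrightarrow> e m = real m * u m - (\<Sum>n=1..<m. e n * u (m - n))"
  shows "\<exists>K. \<forall>m\<ge>1. \<bar>e m - real m * u m\<bar> \<le> K * u m"
proof -
  obtain N :: nat where N: "2 * B \<le> real N"
    using real_arch_simple by blast
  \<comment> \<open>The sum covers the indices up to \<open>N\<close> directly. Beyond
    \<open>N\<close> the error takes at most half of \<open>K * m * u m\<close>, and
    \<open>K \<ge> 2\<close> lets the main term fit into the other half.\<close>
  define K where "K = 2 + (\<Sum>n=1..N. \<bar>e n\<bar> / (real n * u n))"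
  have terms_nonneg: "\<bar>e n\<bar> / (real n * u n) \<ge> 0" for n
    using pos[of n] by (simp add: less_imp_le)
  have K: "K \<ge> 2"
    using terms_nonneg by (simp add: K_def sum_nonneg)
  have step: "\<bar>e m - real m * u m\<bar> \<le> K * B * u m"
    if "m \<ge> 1" and IH: "\<And>n. 1 \<le> n \<Longrightarrow> n < m \<Longrightarrow> \<bar>e n\<bar> \<le> K * (real n * u n)" for m
  proof -
    have "\<bar>e m - real m * u m\<bar> \<le> (\<Sum>n=1..<m. \<bar>e n * u (m - n)\<bar>)"
      using sum_abs[of "\<lambda>n. e n * u (m - n)" "{1..<m}"] rec[OF that(1)] by simp
    also have "\<dots> \<le> (\<Sum>n=1..<m. K * (real n * u n) * u (m - n))"
      using IH pos by (intro sum_mono) (auto simp: abs_mult less_imp_le intro!: mult_right_mono)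
    also have "\<dots> = K * (\<Sum>n=1..<m. real n * u n * u (m - n))"
      by (simp add: sum_distrib_left mult_ac)
    also have "\<dots> \<le> K * (B * u m)"
      using K by (intro mult_left_mono conv) simp
    finally show ?thesis by (simp add: mult_ac)
  qed
  have bound: "\<bar>e m\<bar> \<le> K * (real m * u m)" if "m \<ge> 1" for m
    using that
  proof (induction m rule: less_induct)
    case (less m)
    show ?case
    proof (cases "m \<le> N")
      case True
      have "\<bar>e m\<bar> / (real m * u m) \<le> (\<Sum>n=1..N. \<bar>e n\<bar> / (real n * u n))"
        by (rule member_le_sum) (use True less.prems terms_nonneg in auto)
      then have "\<bar>e m\<bar> / (real m * u m) \<le> K" by (simp add: K_def)
      then show ?thesis
        using less.prems pos[of m] by (simp add: divide_le_eq)
    next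
      case False
      have "\<bar>e m - real m * u m\<bar> \<le> K * B * u m"
        using less by (intro step) auto
      also have "K * B * u m \<le> K * (real m / 2) * u m"
        using False N K pos[of m] by (intro mult_right_mono mult_left_mono) auto
      finally have "\<bar>e m\<bar> \<le> real m * u m + K / 2 * (real m * u m)"
        using abs_triangle_ineq[of "e m - real m * u m" "real m * u m"] pos[of m]
        by (simp add: abs_mult mult_ac)
      also have "\<dots> \<le> K / 2 * (real m * u m) + K / 2 * (real m * u m)"
        using K pos[of m] mult_right_mono[of 1 "K / 2" "real m * u m"] by simp
      finally show ?thesis by simp
    qed
  qed
  show ?thesis
    using step bound by blast
qed

section \<open>The sequence of the logarithmic derivative\<close>

text \<open>The logarithmic derivative of \<open>inverse T\<close> is minus that of
  \<open>T\<close>, so \<open>D * T = - X * T'\<close>. In the coefficient at \<open>m\<close>, the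
  term at \<open>n = 0\<close> vanishes because \<open>D\<close> has no constant term, and the one
  at \<open>n = m\<close> is the coefficient of \<open>D\<close> itself.\<close>

lemma fps_log_deriv_inverse_convolution:
  fixes T :: "'a :: field fps"
  assumes T0: "fps_nth T 0 = 1" and m: "m \<ge> 1"
  defines "D \<equiv> fps_X * fps_deriv (inverse T) / inverse T"
  shows "fps_nth D m = - (\<Sum>n=1..<m. fps_nth D n * fps_nth T (m - n)) - of_nat m * fps_nth T m"
proof -
  have inv: "inverse T * T = 1"
    using T0 by (simp add: inverse_mult_eq_1)
  have "D = fps_X * fps_deriv (inverse T) * T"
    using T0 by (simp add: D_def fps_divide_unit fps_inverse_idempotent)
  also have "fps_deriv (inverse T) = - fps_deriv T * (inverse T)\<^sup>2"
    using T0 by (simp add: fps_inverse_deriv)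
  finally have D: "D = - (fps_X * fps_deriv T) * inverse T * (inverse T * T)"
    by (simp add: power2_eq_square mult_ac)
  then have "D * T = - (fps_X * fps_deriv T) * (inverse T * T) * (inverse T * T)"
    by (simp only: mult_ac)
  then have "fps_nth (D * T) m = - (of_nat m * fps_nth T m)"
    using m by (simp add: inv)
  moreover have "fps_nth D 0 = 0" by (simp add: D)
  moreover have "fps_nth (D * T) m = fps_nth D 0 * fps_nth T m
      + (\<Sum>n=1..<m. fps_nth D n * fps_nth T (m - n)) + fps_nth D m * fps_nth T 0"
  proof -
    have "{0..m} = insert 0 (insert m {1..<m})"
      using m by auto
    then show ?thesis
      using m by (simp add: fps_mult_nth)
  qed
  ultimately show ?thesis using T0 by (simp add: eq_neg_iff_add_eq_0 algebra_simps)
qed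

lemma t_eq_nbin_moment: "t \<alpha> \<gamma> n = (-1) ^ n * (nbin_moment \<alpha> \<gamma> n / \<gamma> ^ n)"
  by (simp add: t_def nbin_moment_def power_int_minus atLeast0AtMost divide_inverse mult_ac)

lemma d_recursion:
  assumes "m \<ge> 1"
  shows "d \<alpha> \<gamma> m = - (\<Sum>n=1..<m. d \<alpha> \<gamma> n * t \<alpha> \<gamma> (m - n)) - real m * t \<alpha> \<gamma> m"
proof -
  define T where "T = 1 + Abs_fps (\<lambda>l. if l \<ge> 1 then t \<alpha> \<gamma> l else 0)"
  \<comment> \<open>Hence the summand 1 in \<open>A\<close> supplies exactly the coefficient
    \<open>t 0\<close>.\<close>
  have "t \<alpha> \<gamma> 0 = 1"
    by (simp add: t_def)
  then have T: "fps_nth T n = t \<alpha> \<gamma> n" for n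
    by (cases n) (simp_all add: T_def)
  have "fps_nth T 0 = 1"
    by (simp add: T_def)
  from fps_log_deriv_inverse_convolution[OF this assms] show ?thesis
    unfolding d_def A_def T_def[symmetric] T .
qed

theorem proposition4p6:
  fixes \<alpha> \<gamma> :: real
  assumes "0 < \<alpha>" and "\<alpha> < 1" and "\<gamma> > 0"
  shows "(\<lambda>m::nat. - (d \<alpha> \<gamma> m / (real m * t \<alpha> \<gamma> m)) - 1) \<in> O(\<lambda>m. 1 / real m)"
proof -
  define u where "u n = nbin_moment \<alpha> \<gamma> n / \<gamma> ^ n" for n
  \<comment> \<open>As \<open>(-1) ^ n * (-1) ^ (m - n) = (-1) ^ m\<close>, this twist removes all
    alternating signs from the recursion and makes the main term \<open>+ m * u m\<close>.\<close>
  define e where "e n = - ((-1) ^ n * d \<alpha> \<gamma> n)" for n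
  define c where "c = \<alpha> / (1 - \<alpha>) / \<gamma>"
  have t: "t \<alpha> \<gamma> n = (-1) ^ n * u n" for n
    by (simp add: t_eq_nbin_moment u_def)
  have pos: "u n > 0" for n
    using assms by (simp add: u_def nbin_moment_pos)
  have convex: "(u (Suc n))\<^sup>2 \<le> u n * u (Suc (Suc n))" for n
  proof -
    have "(u (Suc n))\<^sup>2 = (nbin_moment \<alpha> \<gamma> (Suc n))\<^sup>2 / (\<gamma> ^ Suc n)\<^sup>2"
      by (simp add: u_def power_divide)
    also have "\<dots> \<le> nbin_moment \<alpha> \<gamma> n * nbin_moment \<alpha> \<gamma> (Suc (Suc n)) / (\<gamma> ^ Suc n)\<^sup>2"
      by (intro divide_right_mono nbin_moment_log_convex assms) simp
    \<comment> \<open>Geometric scaling preserves log-convexity: \<open>\<gamma> ^ n * \<gamma> ^ (n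
      + 2) = (\<gamma> ^ (n + 1))\<^sup>2\<close>.\<close>
    also have "\<dots> = u n * u (Suc (Suc n))"
      by (simp add: u_def power2_eq_square mult_ac)
    finally show ?thesis .
  qed
  have growth: "c * real n * u n \<le> u (Suc n)" for n
  proof -
    have "c * real n * u n = \<alpha> / (1 - \<alpha>) * real n * nbin_moment \<alpha> \<gamma> n / \<gamma> ^ Suc n"
      by (simp add: c_def u_def)
    also have "\<dots> \<le> u (Suc n)"
      unfolding u_def using assms by (intro divide_right_mono nbin_moment_growth) auto
    finally show ?thesis .
  qed
  have "c > 0" using assms by (simp add: c_def)
  have rec: "e m = real m * u m - (\<Sum>n=1..<m. e n * u (m - n))" if "m \<ge> 1" for m
  proof -
    have "(-1) ^ m * (\<Sum>n=1..<m. d \<alpha> \<gamma> n * t \<alpha> \<gamma> (m - n)) = - (\<Sum>n=1..<m. e n * u (m - n))"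
      unfolding sum_distrib_left sum_negf[symmetric]
      by (intro sum.cong refl) (auto simp: e_def t minus_one_power_iff)
    then show ?thesis
      unfolding e_def[of m] d_recursion[OF that] by (simp add: t algebra_simps)
  qed
  obtain K where K: "\<And>m. m \<ge> 1 \<Longrightarrow> \<bar>e m - real m * u m\<bar> \<le> K * u m"
    using convolution_recursion_bound[OF pos weighted_convolution_le[OF pos convex \<open>c > 0\<close> growth] rec]
    by blast
  show ?thesis
  proof (rule bigoI)
    show "\<forall>\<^sub>F m in sequentially. norm (- (d \<alpha> \<gamma> m / (real m * t \<alpha> \<gamma> m)) - 1) \<le> K * norm (1 / real m)"
      using eventually_ge_at_top[of 1]
    proof eventually_elim
      case (elim m)
      have "- (d \<alpha> \<gamma> m / (real m * t \<alpha> \<gamma> m)) - 1 = (e m - real m * u m) / (real m * u m)"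
        using elim pos[of m] by (auto simp: e_def t minus_one_power_iff field_simps)
      also have "norm \<dots> = \<bar>e m - real m * u m\<bar> / (real m * u m)"
        using pos[of m] by (simp add: abs_mult)
      also have "\<dots> \<le> K * u m / (real m * u m)"
        using K elim pos[of m] by (intro divide_right_mono) (auto simp: less_imp_le)
      also have "\<dots> = K * norm (1 / real m)"
        using pos[of m] by simp
      finally show ?case .
    qed
  qed
qed

end
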